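(* Let $X\subseteq\mathbb{R}^n$ be a nonempty open set, $C\subseteq\mathbb{R}^m$ a closed pointed convex cone with nonempty interior, $f:X\to\mathbb{R}^m$ locally Lipschitz, $\eta:X\times X\to\mathbb{R}^n$ a mapping, and $e\in\mathbb{R}^m$ with $e>_C 0$. Let $\xi\in X$ and suppose that $f$ is approximate pseudo $(\eta,e)$-invex of type II at $\xi$. If $\xi$ is a solution of (SVVI), then $\xi$ is a local $(\eta,e)$-quasi efficient solution of the vector optimization problem (VOP) $\min_{x\in X} f(x)$.
   Context: Ordering: for $u,v\in\mathbb{R}^m$, $u\ge_C v$ (equivalently $v\le_C u$) means $u-v\in C$, and $u>_C v$ (equivalently $v<_C u$) means $u-v\in\operatorname{int} C$. $B(x_0,r)$ is the open ball of center $x_0$ and radius $r$; only points of $X$ are considered, since $f$ and $\eta$ are defined on $X$ and $X\times X$. Clarke's generalized Jacobian of $f$ at $x\in X$ is the set of $m\times n$ matrices $\partial f(x)=\operatorname{co}\{\lim_{i\to\infty} Jf(x^{(i)}) : x^{(i)}\to x,\ x^{(i)}\in S\}$, where $\operatorname{co}$ is the convex hull, $S$ is the set of points at which $f$ is differentiable, and $Jf$ is the Jacobian matrix (the limits being those that exist). Approximate pseudo $(\eta,e)$-invexity of type II: $f$ has this property at $x_0\in X$ if there is $r>0$ such that for all $x,y\in B(x_0,r)$: if $f(x)-f(y)<_C 0$, then $A_y\,\eta(x,y)+e\,\|\eta(x,y)\|<_C 0$ for all $A_y\in\partial f(y)$. (SVVI): $\xi\in X$ is a solution of (SVVI) if there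 is no $x\in X\setminus\{\xi\}$ such that $A_\xi\,\eta(x,\xi)\le_C 0$ for all $A_\xi\in\partial f(\xi)$. Local $(\eta,e)$-quasi efficient solution: $\xi\in X$ is such a solution of (VOP) if there is $r>0$ such that there is no $x\in B(\xi,r)\setminus\{\xi\}$ satisfying $f(x)+e\,\|\eta(x,\xi)\|\le_C f(\xi)$. *)

theory Defs
  imports "HOL-Analysis.Analysis"
begin

text \<open>
  Maps defined on an open set \<open>X\<close> (resp. on \<open>X \<times> X\<close>) are represented by total functions, and
  every notion below evaluates them only at points of \<open>X\<close>. Since \<open>X\<close> is open,
  differentiability and the Jacobian at a point of \<open>X\<close> do not depend on the values outside \<open>X\<close>.
\<close>

definition cone_le :: "'a::real_normed_vector set \<Rightarrow> 'a \<Rightarrow> 'a \<Rightarrow> bool" where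
  "cone_le C v u \<longleftrightarrow> u - v \<in> C"

definition cone_less :: "'a::real_normed_vector set \<Rightarrow> 'a \<Rightarrow> 'a \<Rightarrow> bool" where
  "cone_less C v u \<longleftrightarrow> u - v \<in> interior C"

definition pointed_cone :: "'a::real_vector set \<Rightarrow> bool" where
  "pointed_cone C \<longleftrightarrow> C \<inter> uminus ` C = {0}"

definition locally_lipschitz_on :: "'a::metric_space set \<Rightarrow> ('a \<Rightarrow> 'b::metric_space) \<Rightarrow> bool" where
  "locally_lipschitz_on X f \<longleftrightarrow> (\<forall>x\<in>X. \<exists>r>0. \<exists>L. L-lipschitz_on (ball x r \<inter> X) f)"

definition clarke_jacobian ::
  "(real^'n) set \<Rightarrow> (real^'n \<Rightarrow> real^'m) \<Rightarrow> real^'n \<Rightarrow> (real^'n^'m) set" where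
  "clarke_jacobian X f x = convex hull
     {A. \<exists>s :: nat \<Rightarrow> real^'n.
           (\<forall>i. s i \<in> X \<and> f differentiable (at (s i))) \<and> s \<longlonglongrightarrow> x \<and>
           (\<lambda>i. jacobian f (at (s i))) \<longlonglongrightarrow> A}"

definition approx_pseudo_invex_II ::
  "(real^'m) set \<Rightarrow> (real^'n) set \<Rightarrow> (real^'n \<Rightarrow> real^'m) \<Rightarrow>
   (real^'n \<Rightarrow> real^'n \<Rightarrow> real^'n) \<Rightarrow> real^'m \<Rightarrow> real^'n \<Rightarrow> bool" where
  "approx_pseudo_invex_II C X f \<eta> e x0 \<longleftrightarrow>
     (\<exists>r>0. \<forall>x \<in> ball x0 r \<inter> X. \<forall>y \<in> ball x0 r \<inter> X.
        cone_less C (f x - f y) 0 \<longrightarrow>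
        (\<forall>A \<in> clarke_jacobian X f y. cone_less C (A *v \<eta> x y + norm (\<eta> x y) *\<^sub>R e) 0))"

definition SVVI_solution ::
  "(real^'m) set \<Rightarrow> (real^'n) set \<Rightarrow> (real^'n \<Rightarrow> real^'m) \<Rightarrow>
   (real^'n \<Rightarrow> real^'n \<Rightarrow> real^'n) \<Rightarrow> real^'n \<Rightarrow> bool" where
  "SVVI_solution C X f \<eta> \<xi> \<longleftrightarrow>
     \<xi> \<in> X \<and>
     \<not> (\<exists>x \<in> X - {\<xi>}. \<forall>A \<in> clarke_jacobian X f \<xi>. cone_le C (A *v \<eta> x \<xi>) 0)"

definition local_quasi_efficient ::
  "(real^'m) set \<Rightarrow> (real^'n) set \<Rightarrow> (real^'n \<Rightarrow> real^'m) \<Rightarrow>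
   (real^'n \<Rightarrow> real^'n \<Rightarrow> real^'n) \<Rightarrow> real^'m \<Rightarrow> real^'n \<Rightarrow> bool" where
  "local_quasi_efficient C X f \<eta> e \<xi> \<longleftrightarrow>
     \<xi> \<in> X \<and>
     (\<exists>r>0. \<not> (\<exists>x \<in> (ball \<xi> r \<inter> X) - {\<xi>}. cone_le C (f x + norm (\<eta> x \<xi>) *\<^sub>R e) (f \<xi>)))"

end

theory Submission
  imports Defs
begin

text \<open>
  The radius of invexity at \<open>\<xi>\<close> also works for quasi efficiency: every
  \<open>x \<noteq> \<xi>\<close> that violates quasi efficiency within it satisfies \<open>A \<eta>(x,\<xi>) \<le> 0\<close> for all
  generalized Jacobians \<open>A\<close> at \<open>\<xi>\<close>, and so violates the variational inequality.
  If \<open>\<eta>(x,\<xi>) = 0\<close>, this holds because \<open>0 \<in> C\<close>. Otherwise \<open>\<parallel>\<eta>(x,\<xi>)\<parallel> e\<close> is interior to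
  the cone, and the estimate \<open>f x + \<parallel>\<eta>(x,\<xi>)\<parallel> e \<le> f \<xi>\<close> sharpens to the strict inequality
  \<open>f x < f \<xi>\<close>, since adding a point of the cone to an interior point gives an interior point.
  Invexity then yields \<open>A \<eta>(x,\<xi>) + \<parallel>\<eta>(x,\<xi>)\<parallel> e < 0\<close>, where the nonnegative multiple of \<open>e\<close>
  can be dropped.
\<close>

text \<open>
  Translating by a point of the cone maps \<open>interior C\<close> onto an open set that stays inside \<open>C\<close>.
\<close>

lemma convex_cone_interior_add:
  fixes C :: "'a::real_normed_vector set"
  assumes "convex_cone C" and "c \<in> C" and "u \<in> interior C"
  shows "c + u \<in> interior C"
proof -
  have "(+) c ` interior C \<subseteq> C"
    using assms(1,2) interior_subset convex_cone_add by blast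
  then have "(+) c ` interior C \<subseteq> interior C"
    by (simp add: interior_maximal open_translation)
  then show ?thesis
    using assms(3) by blast
qed

text \<open>The same argument with the open map \<open>u \<mapsto> t u\<close>.\<close>

lemma convex_cone_interior_scaleR:
  fixes C :: "'a::real_normed_vector set"
  assumes "convex_cone C" and "t > 0" and "u \<in> interior C"
  shows "t *\<^sub>R u \<in> interior C"
proof -
  have "(*\<^sub>R) t ` interior C \<subseteq> C"
    using assms(1,2) interior_subset[of C] by (auto intro!: convex_cone_scaleR)
  then have "(*\<^sub>R) t ` interior C \<subseteq> interior C"
    using assms(2) by (simp add: interior_maximal open_scaling)
  then show ?thesis
    using assms(3) by blast
qed

theorem theorem3p4:
  fixes X :: "(real^'n) set"
    and C :: "(real^'m) set"
    and f :: "real^'n \<Rightarrow> real^'m"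
    and \<eta> :: "real^'n \<Rightarrow> real^'n \<Rightarrow> real^'n"
    and e :: "real^'m"
    and \<xi> :: "real^'n"
  assumes "X \<noteq> {}" and "open X"
    and "closed C" and "convex_cone C" and "pointed_cone C" and "interior C \<noteq> {}"
    and "locally_lipschitz_on X f"
    and "cone_less C 0 e"
    and "\<xi> \<in> X"
    and "approx_pseudo_invex_II C X f \<eta> e \<xi>"
    and "SVVI_solution C X f \<eta> \<xi>"
  shows "local_quasi_efficient C X f \<eta> e \<xi>"
proof -
  have e: "e \<in> interior C"
    using \<open>cone_less C 0 e\<close> by (simp add: cone_less_def)
  obtain r where "r > 0" and invex:
    "\<And>x y A. \<lbrakk>x \<in> ball \<xi> r \<inter> X; y \<in> ball \<xi> r \<inter> X; cone_less C (f x - f y) 0;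
        A \<in> clarke_jacobian X f y\<rbrakk> \<Longrightarrow> cone_less C (A *v \<eta> x y + norm (\<eta> x y) *\<^sub>R e) 0"
    using \<open>approx_pseudo_invex_II C X f \<eta> e \<xi>\<close> unfolding approx_pseudo_invex_II_def by blast
  have "\<not> cone_le C (f x + norm (\<eta> x \<xi>) *\<^sub>R e) (f \<xi>)" if x: "x \<in> (ball \<xi> r \<inter> X) - {\<xi>}" for x
  proof
    assume le: "cone_le C (f x + norm (\<eta> x \<xi>) *\<^sub>R e) (f \<xi>)"
    have "cone_le C (A *v \<eta> x \<xi>) 0" if A: "A \<in> clarke_jacobian X f \<xi>" for A
    proof (cases "\<eta> x \<xi> = 0")
      case True
      then show ?thesis
        using convex_cone_contains_0[OF \<open>convex_cone C\<close>] by (simp add: cone_le_def)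
    next
      case False
      define d where "d = norm (\<eta> x \<xi>) *\<^sub>R e"
      have d: "d \<in> interior C"
        unfolding d_def using False e \<open>convex_cone C\<close> by (simp add: convex_cone_interior_scaleR)
      have "(f \<xi> - (f x + d)) + d \<in> interior C"
        using le d \<open>convex_cone C\<close>
        by (intro convex_cone_interior_add) (simp_all add: cone_le_def d_def)
      then have "cone_less C (f x - f \<xi>) 0"
        by (simp add: cone_less_def)
      then have "cone_less C (A *v \<eta> x \<xi> + d) 0"
        unfolding d_def using invex x A \<open>\<xi> \<in> X\<close> \<open>r > 0\<close> by simp
      then have "- (A *v \<eta> x \<xi> + d) \<in> C"
        using interior_subset by (auto simp: cone_less_def)
      then have "- (A *v \<eta> x \<xi> + d) + d \<in> C"
        using d interior_subset \<open>convex_cone C\<close> by (blast intro: convex_cone_add)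
      then show ?thesis
        by (simp add: cone_le_def)
    qed
    then show False
      using \<open>SVVI_solution C X f \<eta> \<xi>\<close> x unfolding SVVI_solution_def by blast
  qed
  then show ?thesis
    unfolding local_quasi_efficient_def using \<open>\<xi> \<in> X\<close> \<open>r > 0\<close> by blast
qed

end
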